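(* Let $m,n\in\mathbb{N}$, $0\le a\le n$, $0\le b\le m$ be integers. Then the dual of $R_{a,b}$ (with respect to $m,n$) is $\check{R}_{a,b}=V_{n-a,m-b}\cap R_{n,m}$. Consequently, for the family $\mathcal{F}=\{S_{a,0},S_{0,b}\}$ of double stars, $$\mathrm{ex}(m,n,\mathcal{F})=\min\{am,bn\}.$$
   Context: $\mathbb{Z}_+=\{0,1,2,\dots\}$, $\mathbb{N}=\{1,2,\dots\}$, $[0,c]=\{0,\dots,c\}$, $R_{a,b}=[0,a-1]\times[0,b-1]$ (empty if $a=0$ or $b=0$). A Young diagram is a downward-closed subset of $\mathbb{Z}_+^2$. For integers $a,b\ge0$, $V_{a,b}=\mathbb{Z}_+^2\setminus\{(x,y)\colon x\ge a,\ y\ge b\}$. A convex corner of a Young diagram $\mathcal{Y}$ is a maximal point of $\mathcal{Y}$ in the coordinatewise order; a concave corner is a minimal point of $\mathbb{Z}_+^2\setminus\mathcal{Y}$; $\mathcal{I}_{\mathcal{Y}}$ is the set of concave corners. For a Young diagram $\mathcal{Y}\subseteq R_{n,m}$, its dual is the unique Young diagram $\check{\mathcal{Y}}\subseteq R_{n,m}$ whose set of convex corners is $\{(n-a-1,m-b-1)\colon (a,b)\in\mathcal{I}_{\mathcal{Y}},\ 0\le a\le n-1,\ 0\le b\le m-1\}$. For integers $p,q\ge0$, the double star $S_{p,q}$ is obtained from disjoint $K_{1,p}$ and $K_{1,q}$ by adding an edge between the center $u$ of $K_{1,p}$ and the center $v$ of $K_{1,q}$ (so $u$ has degree $p+1$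 and $v$ degree $q+1$); it is equipped with the bipartition $(X_{p,q},Y_{p,q})$ with $u\in X_{p,q}$, $v\in Y_{p,q}$. For a family $\mathcal{F}$ of double stars, $\mathrm{ex}(m,n,\mathcal{F})$ is the maximum number of edges in a bipartite graph with bipartition $(X,Y)$, $|X|=m$, $|Y|=n$, that contains no $S_{p,q}\in\mathcal{F}$ as a (not necessarily induced) subgraph respecting the bipartitions (with $X_{p,q}$ inside $X$ and $Y_{p,q}$ inside $Y$). *)

theory Defs
  imports Main "HOL-Library.Product_Order"
begin

text \<open>Points of the quarter plane are pairs of naturals; \<open>\<le>\<close> and \<open><\<close> on them are the
  coordinatewise ones of \<open>HOL-Library.Product_Order\<close>.\<close>

definition rect :: "nat \<Rightarrow> nat \<Rightarrow> (nat \<times> nat) set" where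
  "rect a b = {0..<a} \<times> {0..<b}"

definition vee :: "nat \<Rightarrow> nat \<Rightarrow> (nat \<times> nat) set" where
  "vee a b = UNIV - {(x, y). x \<ge> a \<and> y \<ge> b}"

definition young_diagram :: "(nat \<times> nat) set \<Rightarrow> bool" where
  "young_diagram Y \<longleftrightarrow> (\<forall>p\<in>Y. \<forall>q. q \<le> p \<longrightarrow> q \<in> Y)"

definition convex_corners :: "(nat \<times> nat) set \<Rightarrow> (nat \<times> nat) set" where
  "convex_corners Y = {p \<in> Y. \<not> (\<exists>q\<in>Y. p < q)}"

definition concave_corners :: "(nat \<times> nat) set \<Rightarrow> (nat \<times> nat) set" where
  "concave_corners Y = {p. p \<notin> Y \<and> \<not> (\<exists>q. q \<notin> Y \<and> q < p)}"

definition dual :: "nat \<Rightarrow> nat \<Rightarrow> (nat \<times> nat) set \<Rightarrow> (nat \<times> nat) set" where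
  "dual n m Y = (THE Z. young_diagram Z \<and> Z \<subseteq> rect n m \<and>
     convex_corners Z =
       {(n - a - 1, m - b - 1) | a b. (a, b) \<in> concave_corners Y \<and> a < n \<and> b < m})"

text \<open>A graph with an ordered pair of vertex classes; edges are two-element sets.\<close>

record 'a bigraph =
  lpart :: "'a set"
  rpart :: "'a set"
  edges :: "'a set set"

definition bipartite_graph :: "'a bigraph \<Rightarrow> bool" where
  "bipartite_graph G \<longleftrightarrow> finite (lpart G) \<and> finite (rpart G) \<and> lpart G \<inter> rpart G = {} \<and>
     edges G \<subseteq> {{x, y} | x y. x \<in> lpart G \<and> y \<in> rpart G}"

text \<open>Containment as a subgraph, not necessarily induced, respecting the ordered bipartitions.\<close>

definition contains :: "'b bigraph \<Rightarrow> 'a bigraph \<Rightarrow> bool" where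
  "contains G H \<longleftrightarrow> (\<exists>f. inj_on f (lpart H \<union> rpart H) \<and>
     f ` lpart H \<subseteq> lpart G \<and> f ` rpart H \<subseteq> rpart G \<and> (\<forall>e\<in>edges H. f ` e \<in> edges G))"

text \<open>The star $K_{1,p}$ lives on \<open>{0..p}\<close>, with center \<open>0\<close>.\<close>

definition star_edges :: "nat \<Rightarrow> nat set set" where
  "star_edges p = {{0, i} | i. 1 \<le> i \<and> i \<le> p}"

text \<open>The centers are \<open>u = Inl 0\<close> and \<open>v = Inr 0\<close>. The left class contains \<open>u\<close>, hence also
  the \<open>q\<close> leaves at \<open>v\<close>.\<close>

definition double_star :: "nat \<Rightarrow> nat \<Rightarrow> (nat + nat) bigraph" where
  "double_star p q =
     \<lparr> lpart = insert (Inl 0) (Inr ` {1..q}),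
       rpart = insert (Inr 0) (Inl ` {1..p}),
       edges = insert {Inl 0, Inr 0}
         ((\<lambda>e. Inl ` e) ` star_edges p \<union> (\<lambda>e. Inr ` e) ` star_edges q) \<rparr>"

text \<open>Taking host graphs on vertices of type \<^typ>\<open>nat\<close> loses nothing, as every finite graph is
  isomorphic to one of these. The set is finite (edge counts are at most \<open>m * n\<close>), and it
  contains \<open>0\<close> whenever every graph in \<open>F\<close> has an edge, as all double stars do.\<close>

definition extremal_number :: "nat \<Rightarrow> nat \<Rightarrow> 'a bigraph set \<Rightarrow> nat" where
  "extremal_number m n F = Max {card (edges G) | G :: nat bigraph.
     bipartite_graph G \<and> card (lpart G) = m \<and> card (rpart G) = n \<and> (\<forall>H\<in>F. \<not> contains G H)}"

end

theory Submission imports Defs begin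

text \<open>
  A finite Young diagram is the down-closure of its convex corners, so the dual is determined by
  them, and the corners of \<^term>\<open>rect a b\<close> and of its proposed dual are read off directly.
  A graph avoids \<^term>\<open>double_star a 0\<close> iff its left degrees are at most \<open>a\<close>, and
  \<^term>\<open>double_star 0 b\<close> iff its right degrees are at most \<open>b\<close>; counting edges from either side
  gives the upper bound. If \<open>a * m \<le> b * n\<close>, distributing the \<open>a * m\<close> edges cyclically, the
  \<open>k\<close>-th one joining \<open>k div a\<close> to \<open>k mod n\<close>, attains it.
\<close>

section \<open>Corners and duals of Young diagrams\<close>

lemma less_Pair_iff:
  fixes x u :: "'a :: order" and y v :: "'b :: order"
  shows "(x, y) < (u, v) \<longleftrightarrow> x \<le> u \<and> y \<le> v \<and> (x < u \<or> y < v)"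
  by (auto simp: less_le_not_le)

text \<open>A point of \<open>Y\<close> strictly above \<open>(x, y)\<close> dominates one of the
  two unit successors, and down-closure then puts that successor into \<open>Y\<close>. So a
  maximality test is reduced to two membership tests.\<close>

lemma convex_corners_iff:
  assumes "young_diagram Y"
  shows "(x, y) \<in> convex_corners Y \<longleftrightarrow> (x, y) \<in> Y \<and> (Suc x, y) \<notin> Y \<and> (x, Suc y) \<notin> Y"
    (is "_ \<longleftrightarrow> ?R")
proof
  assume C: "(x, y) \<in> convex_corners Y"
  have "(x, y) < (Suc x, y)" "(x, y) < (x, Suc y)"
    by (auto simp: less_Pair_iff)
  with C show ?R
    unfolding convex_corners_def by blast
next
  assume R: ?R
  have False if "(u, v) \<in> Y" "(x, y) < (u, v)" for u v
  proof -
    have "(Suc x, y) \<le> (u, v) \<or> (x, Suc y) \<le> (u, v)"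
      using that(2) by (auto simp: less_Pair_iff)
    then show False
      using R that(1) assms unfolding young_diagram_def by blast
  qed
  with R show "(x, y) \<in> convex_corners Y"
    by (auto simp: convex_corners_def)
qed

text \<open>The same reduction on the complement, which is closed upwards. The disjuncts
  \<open>x = 0\<close> and \<open>y = 0\<close> guard against truncated subtraction.\<close>

lemma concave_corners_iff:
  assumes "young_diagram Y"
  shows "(x, y) \<in> concave_corners Y \<longleftrightarrow>
    (x, y) \<notin> Y \<and> (x = 0 \<or> (x - 1, y) \<in> Y) \<and> (y = 0 \<or> (x, y - 1) \<in> Y)"
    (is "_ \<longleftrightarrow> ?R")
proof
  assume C: "(x, y) \<in> concave_corners Y"
  have "(x - 1, y) < (x, y)" if "x \<noteq> 0"
    using that by (auto simp: less_Pair_iff)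
  moreover have "(x, y - 1) < (x, y)" if "y \<noteq> 0"
    using that by (auto simp: less_Pair_iff)
  ultimately show ?R
    using C unfolding concave_corners_def by blast
next
  assume R: ?R
  have False if "(u, v) \<notin> Y" "(u, v) < (x, y)" for u v
  proof -
    have "x \<noteq> 0 \<and> (u, v) \<le> (x - 1, y) \<or> y \<noteq> 0 \<and> (u, v) \<le> (x, y - 1)"
      using that(2) by (auto simp: less_Pair_iff)
    then show False
      using R that(1) assms unfolding young_diagram_def by blast
  qed
  with R show "(x, y) \<in> concave_corners Y"
    by (auto simp: concave_corners_def)
qed

text \<open>Finiteness puts a maximal point above every point; an infinite diagram such as the whole
  quadrant may have no convex corner at all.\<close>

lemma young_diagram_eq_downset_convex_corners:
  assumes "young_diagram Y" and "finite Y"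
  shows "Y = {q. \<exists>p\<in>convex_corners Y. q \<le> p}"
proof (intro equalityI subsetI CollectI)
  fix q assume "q \<in> Y"
  then obtain p where p: "p \<in> Y" "q \<le> p" "\<forall>r\<in>Y. p \<le> r \<longrightarrow> p = r"
    using finite_has_maximal2[OF assms(2)] by blast
  have "\<not> p < r" if "r \<in> Y" for r
    using p(3) that order.strict_implies_order[of p r] order.irrefl[of p] by blast
  with p(1,2) show "\<exists>p\<in>convex_corners Y. q \<le> p"
    unfolding convex_corners_def by blast
next
  fix q assume "q \<in> {q. \<exists>p\<in>convex_corners Y. q \<le> p}"
  then show "q \<in> Y"
    using assms(1) unfolding convex_corners_def young_diagram_def by blast
qed

lemma finite_rect: "finite (rect a b)"
  by (simp add: rect_def)

text \<open>Discharges the description operator in \<open>dual\<close>: any candidate lies in a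
  finite rectangle, hence is the down-closure of the prescribed corners, so it equals
  \<open>Z\<close>.\<close>

lemma dual_eqI:
  assumes "young_diagram Z" and "Z \<subseteq> rect n m"
    and "convex_corners Z =
      {(n - a - 1, m - b - 1) | a b. (a, b) \<in> concave_corners Y \<and> a < n \<and> b < m}"
  shows "dual n m Y = Z"
  unfolding dual_def
proof (rule the_equality)
  fix W
  assume W: "young_diagram W \<and> W \<subseteq> rect n m \<and> convex_corners W =
      {(n - a - 1, m - b - 1) | a b. (a, b) \<in> concave_corners Y \<and> a < n \<and> b < m}"
  then have "convex_corners W = convex_corners Z"
    using assms(3) by simp
  moreover have "finite W" "finite Z"
    using W assms(2) finite_rect finite_subset by metis+
  ultimately show "W = Z"
    using young_diagram_eq_downset_convex_corners[of W]
      young_diagram_eq_downset_convex_corners[of Z] W assms(1) by simp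
qed (use assms in simp)

section \<open>The dual of a rectangle\<close>

lemma young_diagram_rect: "young_diagram (rect a b)"
  by (auto simp: young_diagram_def rect_def)

lemma young_diagram_vee_Int_rect: "young_diagram (vee a b \<inter> rect n m)"
  unfolding young_diagram_def vee_def rect_def by (clarsimp; linarith)

lemma concave_corners_rect:
  "concave_corners (rect a b) = (if a = 0 \<or> b = 0 then {(0, 0)} else {(a, 0), (0, b)})"
proof -
  have "(x, y) \<in> concave_corners (rect a b) \<longleftrightarrow>
      (x, y) \<in> (if a = 0 \<or> b = 0 then {(0, 0)} else {(a, 0), (0, b)})" for x y
    unfolding concave_corners_iff[OF young_diagram_rect] by (auto simp: rect_def)
  then show ?thesis by auto
qed

lemma dual_rect:
  assumes "1 \<le> m" and "1 \<le> n" and "a \<le> n" and "b \<le> m"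
  shows "dual n m (rect a b) = vee (n - a) (m - b) \<inter> rect n m"
proof (rule dual_eqI[OF young_diagram_vee_Int_rect])
  \<comment> \<open>The reflections of the concave corners \<open>(a, 0)\<close> and
    \<open>(0, b)\<close>, each kept only if it lies in \<open>rect n m\<close>. For an empty
    rectangle the only concave corner is the origin, and the dual is all of
    \<open>rect n m\<close>.\<close>
  let ?C = "if a = 0 \<or> b = 0 then {(n - 1, m - 1)}
    else {p. a < n \<and> p = (n - a - 1, m - 1) \<or> b < m \<and> p = (n - 1, m - b - 1)}"
  have "(x, y) \<in> convex_corners (vee (n - a) (m - b) \<inter> rect n m) \<longleftrightarrow> (x, y) \<in> ?C" for x y
    unfolding convex_corners_iff[OF young_diagram_vee_Int_rect]
    using assms by (auto simp: vee_def rect_def)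
  then have "convex_corners (vee (n - a) (m - b) \<inter> rect n m) = ?C"
    by auto
  also have "?C =
      {(n - c - 1, m - d - 1) | c d. (c, d) \<in> concave_corners (rect a b) \<and> c < n \<and> d < m}"
    using assms
    by (auto simp: concave_corners_rect ex_disj_distrib conj_disj_distribL conj_disj_distribR)
  finally show "convex_corners (vee (n - a) (m - b) \<inter> rect n m) =
      {(n - c - 1, m - d - 1) | c d. (c, d) \<in> concave_corners (rect a b) \<and> c < n \<and> d < m}" .
qed auto

section \<open>Degrees in bipartite graphs\<close>

text \<open>Lets facts about left degrees be reused for right degrees.\<close>

definition flip :: "'a bigraph \<Rightarrow> 'a bigraph" where
  "flip G = \<lparr>lpart = rpart G, rpart = lpart G, edges = edges G\<rparr>"

lemma flip_simps [simp]:
  "lpart (flip G) = rpart G" "rpart (flip G) = lpart G" "edges (flip G) = edges G"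
  "flip (flip G) = G"
  by (simp_all add: flip_def)

lemma bipartite_graph_flip [simp]: "bipartite_graph (flip G) \<longleftrightarrow> bipartite_graph G"
proof -
  have "{{x, y} | x y. x \<in> rpart G \<and> y \<in> lpart G} = {{x, y} | x y. x \<in> lpart G \<and> y \<in> rpart G}"
    by (auto simp: insert_commute)
  then show ?thesis by (auto simp: bipartite_graph_def)
qed

lemma contains_flip: "contains (flip G) (flip H) \<longleftrightarrow> contains G H"
  by (auto simp: contains_def Un_commute)

text \<open>Depends on the edges alone, so it serves both classes and is invariant under
  \<open>flip\<close>.\<close>

definition neighbours :: "'a bigraph \<Rightarrow> 'a \<Rightarrow> 'a set" where
  "neighbours G x = {y. {x, y} \<in> edges G}"

lemma neighbours_flip [simp]: "neighbours (flip G) = neighbours G"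
  by (simp add: neighbours_def fun_eq_iff)

lemma neighbours_subset_rpart:
  assumes "bipartite_graph G" and "x \<in> lpart G"
  shows "neighbours G x \<subseteq> rpart G"
  using assms unfolding bipartite_graph_def neighbours_def
  by (fastforce simp: doubleton_eq_iff)

text \<open>An embedding of a star amounts to an image of the centre and an injection of the leaves
  into its neighbourhood.\<close>

lemma contains_star_iff:
  assumes G: "bipartite_graph G" and "c \<notin> L" and "finite L"
  shows "contains G \<lparr>lpart = {c}, rpart = L, edges = (\<lambda>l. {c, l}) ` L\<rparr> \<longleftrightarrow>
    (\<exists>x\<in>lpart G. card L \<le> card (neighbours G x))"
    (is "?C \<longleftrightarrow> ?D")
proof
  assume ?C
  then obtain f where f: "inj_on f ({c} \<union> L)" "f c \<in> lpart G" "\<forall>l\<in>L. {f c, f l} \<in> edges G"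
    by (auto simp: contains_def)
  have "finite (neighbours G (f c))"
    using neighbours_subset_rpart[OF G f(2)] G finite_subset
    unfolding bipartite_graph_def by blast
  moreover have "f ` L \<subseteq> neighbours G (f c)"
    using f(3) by (auto simp: neighbours_def)
  ultimately have "card L \<le> card (neighbours G (f c))"
    using f(1) card_inj_on_le inj_on_Un by metis
  with f(2) show ?D by blast
next
  assume ?D
  then obtain x where x: "x \<in> lpart G" "card L \<le> card (neighbours G x)" by blast
  have N: "neighbours G x \<subseteq> rpart G"
    by (rule neighbours_subset_rpart[OF G x(1)])
  then have "finite (neighbours G x)"
    using G finite_subset unfolding bipartite_graph_def by blast
  then obtain g where g: "inj_on g L" "g ` L \<subseteq> neighbours G x"
    using card_le_inj[OF assms(3) _ x(2)] by blast
  \<comment> \<open>Disjointness of the classes keeps the image of the centre apart from those of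
    the leaves, so the extended map stays injective.\<close>
  have "x \<notin> rpart G"
    using G x(1) by (auto simp: bipartite_graph_def)
  with N g(2) have "x \<notin> g ` L" by blast
  define f where "f = g(c := x)"
  have fL: "f l = g l" if "l \<in> L" for l
    using that assms(2) by (auto simp: f_def)
  have fc: "f c = x" by (simp add: f_def)
  have "f ` L = g ` L" "inj_on f L"
    using fL g(1) by (auto cong: inj_on_cong image_cong)
  then show ?C
    unfolding contains_def using g(2) N x(1) \<open>x \<notin> g ` L\<close> assms(2) fL fc
    by (intro exI[of _ f]) (auto simp: neighbours_def)
qed

section \<open>Double stars and degree bounds\<close>

lemma star_edges_eq_image: "star_edges p = (\<lambda>i. {0, i}) ` {1..p}"
  by (auto simp: star_edges_def)

text \<open>The centre \<open>Inr 0\<close> has no leaves of its own and acts as one more leaf of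
  \<open>Inl 0\<close>. This gives a star with \<open>p + 1\<close> leaves, whence the strict
  inequality in the degree criterion.\<close>

lemma double_star_left:
  "double_star p 0 = \<lparr>lpart = {Inl 0}, rpart = insert (Inr 0) (Inl ` {1..p}),
     edges = (\<lambda>l. {Inl 0, l}) ` insert (Inr 0) (Inl ` {1..p})\<rparr>"
  by (simp add: double_star_def star_edges_eq_image image_image)

lemma double_star_right:
  "double_star 0 q = flip \<lparr>lpart = {Inr 0}, rpart = insert (Inl 0) (Inr ` {1..q}),
     edges = (\<lambda>l. {Inr 0, l}) ` insert (Inl 0) (Inr ` {1..q})\<rparr>"
  by (simp add: double_star_def star_edges_eq_image flip_def image_image insert_commute)

lemma contains_double_star_left_iff:
  assumes "bipartite_graph G"
  shows "contains G (double_star p 0) \<longleftrightarrow> (\<exists>x\<in>lpart G. p < card (neighbours G x))"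
proof -
  have "card (insert (Inr 0) (Inl ` {1..p}) :: (nat + nat) set) = Suc p"
    by (subst card_insert_disjoint) (auto simp: card_image)
  then show ?thesis
    unfolding double_star_left by (subst contains_star_iff[OF assms]; auto simp: Suc_le_eq)
qed

lemma contains_double_star_right_iff:
  assumes "bipartite_graph G"
  shows "contains G (double_star 0 q) \<longleftrightarrow> (\<exists>y\<in>rpart G. q < card (neighbours G y))"
proof -
  have "card (insert (Inl 0) (Inr ` {1..q}) :: (nat + nat) set) = Suc q"
    by (subst card_insert_disjoint) (auto simp: card_image)
  moreover have "bipartite_graph (flip G)" using assms by simp
  moreover have "contains G (flip H) \<longleftrightarrow> contains (flip G) H" for H :: "(nat + nat) bigraph"
    using contains_flip[of "flip G" H] by simp
  ultimately show ?thesis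
    unfolding double_star_right by (simp only:) (subst contains_star_iff; auto simp: Suc_le_eq)
qed

lemma card_edges_le:
  assumes G: "bipartite_graph G" and deg: "\<And>x. x \<in> lpart G \<Longrightarrow> card (neighbours G x) \<le> d"
  shows "card (edges G) \<le> d * card (lpart G)"
proof -
  have fin: "finite (lpart G)" "finite (rpart G)"
    using G by (auto simp: bipartite_graph_def)
  let ?E = "\<lambda>x. (\<lambda>y. {x, y}) ` neighbours G x"
  have finN: "finite (neighbours G x)" if "x \<in> lpart G" for x
    using neighbours_subset_rpart[OF G that] fin(2) finite_subset by blast
  have "edges G \<subseteq> (\<Union>x\<in>lpart G. ?E x)"
    using G unfolding bipartite_graph_def neighbours_def by fastforce
  then have "card (edges G) \<le> card (\<Union>x\<in>lpart G. ?E x)"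
    using fin(1) finN by (intro card_mono) auto
  also have "\<dots> \<le> (\<Sum>x\<in>lpart G. card (?E x))"
    by (rule card_UN_le[OF fin(1)])
  also have "\<dots> \<le> (\<Sum>x\<in>lpart G. d)"
    using deg finN card_image_le le_trans by (intro sum_mono) blast
  finally show ?thesis by (simp add: mult.commute)
qed

section \<open>The cyclic construction\<close>

lemma cyclic_bipartite_relation:
  fixes m n a b :: nat
  assumes "a \<le> n" and "a * m \<le> b * n"
  obtains E where "E \<subseteq> {..<m} \<times> {..<n}" "card E = a * m"
    "\<And>x. card (E `` {x}) \<le> a" "\<And>y. card (E\<inverse> `` {y}) \<le> b"
proof (cases "a = 0")
  case True
  show ?thesis by (rule that[of "{}"]) (simp_all add: True)
next
  case False
  then have a: "a > 0" and n: "n > 0" using assms(1) by auto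
  define h where "h k = (k div a, k mod n)" for k
  define E where "E = h ` {..<a * m}"
  \<comment> \<open>Equal quotients by \<open>a\<close> force a difference below \<open>a\<close>,
    hence below \<open>n\<close>; equal residues make it a multiple of \<open>n\<close>, so it is
    zero.\<close>
  have "k = k'" if "k div a = k' div a" "k mod n = k' mod n" "k \<le> k'" for k k'
  proof -
    have "n dvd k' - k"
      using that by (metis mod_eq_dvd_iff_nat)
    moreover have "k' < k + a"
      using mod_less_divisor[OF a, of k'] div_mult_mod_eq[of k a]
        div_mult_mod_eq[of k' a, folded that(1)] by linarith
    then have "k' - k < n" using a assms(1) by linarith
    ultimately show "k = k'"
      using that(3) by (auto dest: dvd_imp_le)
  qed
  then have "inj_on h {..<a * m}"
    unfolding h_def by (intro inj_onI) (metis nat_le_linear prod.inject)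
  then have "card E = a * m"
    by (simp add: E_def card_image)
  moreover have "E \<subseteq> {..<m} \<times> {..<n}"
    using n by (auto simp: E_def h_def less_mult_imp_div_less mult.commute)
  moreover have "card (E `` {x}) \<le> a" for x
  proof -
    \<comment> \<open>The indices \<open>k\<close> with quotient \<open>x\<close> are among the
      \<open>a\<close> consecutive numbers \<open>x * a + r\<close>.\<close>
    have "E `` {x} \<subseteq> (\<lambda>r. (x * a + r) mod n) ` {..<a}"
    proof
      fix y assume "y \<in> E `` {x}"
      then obtain k where "k div a = x" "y = k mod n"
        by (auto simp: E_def h_def)
      then have "y = (x * a + k mod a) mod n" by (metis div_mult_mod_eq)
      then show "y \<in> (\<lambda>r. (x * a + r) mod n) ` {..<a}" using a by auto
    qed
    then show ?thesis
      using surj_card_le[of "{..<a}"] by fastforce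
  qed
  moreover have "card (E\<inverse> `` {y}) \<le> b" for y
  proof -
    \<comment> \<open>The indices with residue \<open>y\<close> have the form
      \<open>j * n + y\<close>, and \<open>k < a * m \<le> b * n\<close> leaves only
      \<open>j < b\<close>.\<close>
    have "E\<inverse> `` {y} \<subseteq> (\<lambda>j. (j * n + y) div a) ` {..<b}"
    proof
      fix x assume "x \<in> E\<inverse> `` {y}"
      then obtain k where k: "k < a * m" "x = k div a" "k mod n = y"
        by (auto simp: E_def h_def)
      then have "k div n < b"
        using assms(2) by (intro less_mult_imp_div_less) linarith
      moreover have "x = (k div n * n + y) div a" using k by (metis div_mult_mod_eq)
      ultimately show "x \<in> (\<lambda>j. (j * n + y) div a) ` {..<b}" by auto
    qed
    then show ?thesis
      using surj_card_le[of "{..<b}"] by fastforce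
  qed
  ultimately show ?thesis using that by blast
qed

lemma extremal_bipartite_relation:
  fixes m n a b :: nat
  assumes "a \<le> n" and "b \<le> m"
  obtains E where "E \<subseteq> {..<m} \<times> {..<n}" "card E = min (a * m) (b * n)"
    "\<And>x. card (E `` {x}) \<le> a" "\<And>y. card (E\<inverse> `` {y}) \<le> b"
proof (cases "a * m \<le> b * n")
  case True
  then show ?thesis
    using cyclic_bipartite_relation[OF assms(1) True] that by (metis min_absorb1)
next
  case False
  \<comment> \<open>Now \<open>b * n\<close> is the smaller product: the construction is run with
    the two sides exchanged, and its converse is taken.\<close>
  then obtain E where E: "E \<subseteq> {..<n} \<times> {..<m}" "card E = b * n"
    "\<And>x. card (E `` {x}) \<le> b" "\<And>y. card (E\<inverse> `` {y}) \<le> a"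
    using cyclic_bipartite_relation[OF assms(2), of n a] by (metis nat_le_linear)
  show ?thesis
    by (rule that[of "E\<inverse>"]) (use E False in auto)
qed

text \<open>The second coordinate is shifted by \<open>m\<close> so that the two classes are
  disjoint sets of naturals.\<close>

definition relation_graph :: "nat \<Rightarrow> nat \<Rightarrow> (nat \<times> nat) set \<Rightarrow> nat bigraph" where
  "relation_graph m n E =
     \<lparr>lpart = {..<m}, rpart = {m..<m + n}, edges = (\<lambda>(x, y). {x, m + y}) ` E\<rparr>"

lemma relation_graph_simps [simp]:
  "lpart (relation_graph m n E) = {..<m}" "rpart (relation_graph m n E) = {m..<m + n}"
  by (simp_all add: relation_graph_def)

text \<open>Because of the shift, the neighbourhood of a left vertex is a translate of its image
  under \<open>E\<close>, so only the cardinalities are compared; that of a right vertex is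
  exact.\<close>

lemma
  assumes "E \<subseteq> {..<m} \<times> {..<n}"
  shows bipartite_graph_relation_graph: "bipartite_graph (relation_graph m n E)"
    and card_edges_relation_graph: "card (edges (relation_graph m n E)) = card E"
    and neighbours_relation_graph_left:
      "x < m \<Longrightarrow> card (neighbours (relation_graph m n E) x) = card (E `` {x})"
    and neighbours_relation_graph_right:
      "neighbours (relation_graph m n E) (m + y) = E\<inverse> `` {y}"
proof -
  show "bipartite_graph (relation_graph m n E)"
    using assms unfolding bipartite_graph_def relation_graph_def by fastforce
  have "inj_on (\<lambda>(x, y). {x, m + y}) E"
    using assms by (fastforce simp: inj_on_def doubleton_eq_iff)
  then show "card (edges (relation_graph m n E)) = card E"
    by (simp add: relation_graph_def card_image)
  have "neighbours (relation_graph m n E) x = (+) m ` (E `` {x})" if "x < m" for x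
    using assms that
    by (fastforce simp: neighbours_def relation_graph_def doubleton_eq_iff image_iff)
  then show "x < m \<Longrightarrow> card (neighbours (relation_graph m n E) x) = card (E `` {x})"
    by (simp add: card_image)
  show "neighbours (relation_graph m n E) (m + y) = E\<inverse> `` {y}"
    using assms
    by (fastforce simp: neighbours_def relation_graph_def doubleton_eq_iff image_iff)
qed

section \<open>The extremal number\<close>

lemma extremal_number_double_stars:
  assumes "a \<le> n" and "b \<le> m"
  shows "extremal_number m n {double_star a 0, double_star 0 b} = min (a * m) (b * n)"
    (is "extremal_number m n ?F = _")
proof -
  let ?S = "{card (edges G) | G :: nat bigraph. bipartite_graph G \<and> card (lpart G) = m \<and>
    card (rpart G) = n \<and> (\<forall>H\<in>?F. \<not> contains G H)}"
  have upper: "card (edges G) \<le> min (a * m) (b * n)"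
    if G: "bipartite_graph G" "card (lpart G) = m" "card (rpart G) = n"
      "\<forall>H\<in>?F. \<not> contains G H" for G :: "nat bigraph"
  proof -
    have "card (neighbours G x) \<le> a" if "x \<in> lpart G" for x
      using G(4) that by (auto simp: contains_double_star_left_iff[OF G(1)] not_less)
    then have "card (edges G) \<le> a * m"
      using card_edges_le[OF G(1)] G(2) by blast
    moreover have "card (neighbours G y) \<le> b" if "y \<in> rpart G" for y
      using G(4) that by (auto simp: contains_double_star_right_iff[OF G(1)] not_less)
    \<comment> \<open>Flipping the graph turns the left-hand edge count into a count from the
      right.\<close>
    then have "card (edges G) \<le> b * n"
      using card_edges_le[of "flip G" b] G(1,3) by simp
    ultimately show ?thesis by simp
  qed
  obtain E where E: "E \<subseteq> {..<m} \<times> {..<n}" "card E = min (a * m) (b * n)"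
    "\<And>x. card (E `` {x}) \<le> a" "\<And>y. card (E\<inverse> `` {y}) \<le> b"
    using extremal_bipartite_relation[OF assms] by blast
  let ?G = "relation_graph m n E"
  have G: "bipartite_graph ?G" by (rule bipartite_graph_relation_graph[OF E(1)])
  have "\<not> contains ?G (double_star a 0)"
    using E(3) by (auto simp: contains_double_star_left_iff[OF G]
        neighbours_relation_graph_left[OF E(1)] not_less)
  moreover have "card (neighbours ?G y) \<le> b" if "y \<ge> m" for y
    using E(4) neighbours_relation_graph_right[OF E(1), of "y - m"] that by simp
  then have "\<not> contains ?G (double_star 0 b)"
    by (auto simp: contains_double_star_right_iff[OF G] not_less)
  ultimately have "min (a * m) (b * n) \<in> ?S"
    using G E(2) card_edges_relation_graph[OF E(1)]
    by (intro CollectI exI[of _ ?G]) auto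
  \<comment> \<open>\<open>Max\<close> is meaningful only on a finite set; the upper bound supplies
    finiteness.\<close>
  moreover have "finite ?S"
    by (rule finite_subset[of _ "{..min (a * m) (b * n)}"]) (use upper in auto)
  ultimately show ?thesis
    unfolding extremal_number_def using upper by (intro Max_eqI) auto
qed

theorem corollary3p2:
  fixes m n a b :: nat
  assumes "1 \<le> m" and "1 \<le> n" and "a \<le> n" and "b \<le> m"
  shows "dual n m (rect a b) = vee (n - a) (m - b) \<inter> rect n m
    \<and> extremal_number m n {double_star a 0, double_star 0 b} = min (a * m) (b * n)"
  using dual_rect[OF assms] extremal_number_double_stars[OF assms(3,4)] by blast

end
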